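(* Let $\nu$ be a nonnegative integer, $T>0$ and $N=\lfloor T/\Delta t\rfloor$. With the grid quantities $A_j^n,B_j^n,D_j^n,E_j^n,C_{A,j}^n,C_{D,j}^n,\mathcal{A}_j^n,\mathcal{D}_j^n$ of the context, define $$I^n=\Delta x^2\sum_{\substack{j,\ell\in\Omega_n\\ j\le\ell}}A_j^nD_\ell^n.$$ Then $$\tfrac12\Delta t\,\Delta x\sum_{n=0}^N\sum_{j\in\Omega_n}\left(A_j^nE_j^n-D_j^nB_j^n\right)=-\Delta x\sum_{n=0}^N\sum_{j\in\Omega_n'}C_{D,j}^n\,\mathcal{A}_j^{n+1}-\Delta x\sum_{n=0}^N\sum_{j\in\Omega_n'}C_{A,j}^n\,\tfrac12\left(\mathcal{D}_{j-1}^n+\mathcal{D}_{j+1}^n\right)+I^{N+1}-I^0+\mathcal{E},$$ where $$\begin{aligned}\mathcal{E}=&\ \tfrac{\lambda}{4}\Delta t\,\Delta x\sum_{n=0}^N\sum_{j\in\Omega_n'}E_{j-1}^n\left(B_{j+1}^n-B_{j-1}^n\right)-\tfrac14\Delta t\,\Delta x\sum_{n=0}^N\sum_{j\in\Omega_n'}B_{j+1}^n\left(D_{j+1}^n-D_{j-1}^n\right)\\&-\tfrac{1}{4\lambda}\Delta t\,\Delta x\sum_{n=0}^N\sum_{j\in\Omega_n'}\left(D_{j-1}^n+\lambda E_{j-1}^n\right)\left(A_{j+1}^n-A_{j-1}^n\right)-\tfrac12\Delta t\,\Delta x\sum_{n=0}^N\sum_{j\in\Omega_n'}E_{j-1}^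nC_{A,j}^n.\end{aligned}$$
   Context: Data. $\mathbb{R}_+=(0,\infty)$; $a<b$, $\alpha<\beta$ fixed reals. $u_0\in L^\infty(\mathbb{R})$ with $a\le u_0\le b$ a.e.; $k\in L^\infty\cap BV(\mathbb{R}\times\mathbb{R}_+)$ with $\alpha\le k\le\beta$ a.e., where $k(\cdot,t)$ denotes the everywhere-defined right-continuous representative; $f\in C^1([\alpha,\beta]\times[a,b])$ with $f(\cdot,a)=f(\cdot,b)=0$; $S\in C^2$, $Q\in C^1$ on $[\alpha,\beta]\times[a,b]$ with $\partial_uQ=\partial_uS\,\partial_uf$ (derivatives in the second variable). Grid and scheme. $\Delta x,\Delta t>0$, $\lambda=\Delta t/\Delta x$, $\lambda\max|\partial_uf|\le1-\kappa$ for a fixed $\kappa\in(0,1)$; $x_j=j\Delta x$, $t^n=n\Delta t$; $\Omega_n=\{j\in\mathbb{Z}:j+n\text{ even}\}$, $\Omega_n'=\{j\in\mathbb{Z}:j+n\text{ odd}\}$; $k_j^n=k(x_j,\hat t_n)$ with $\hat t_n\in[t^n,t^{n+1})$ chosen arbitrarily. For $j\in\Omega_0$, $U_j^0=\frac1{2\Delta x}\int_{x_{j-1}}^{x_{j+1}}u_0\,dx$, and for $j\in\Omega_n'$, $U_j^{n+1}=\frac12(U_{j-1}^n+U_{j+1}^n)-\frac\lambda2(f_{j+1}^n-f_{j-1}^n)$; all $U_j^n\in[a,b]$. Write $f_j^n=f(k_j^n,U_j^n)$, $S_j^n=S(k_j^n,U_j^n)$, $Q_j^n=Q(k_j^n,U_j^n)$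 for $j\in\Omega_n$, and $\Psi_j^n=S_j^{n+1}-\frac12(S_{j-1}^n+S_{j+1}^n)+\frac\lambda2(Q_{j+1}^n-Q_{j-1}^n)$ for $j\in\Omega_n'$. Weight function: $\chi\in C^1(\mathbb{R})\cap L^1(\mathbb{R})$, $\chi>0$, $|\chi'|\le C_\chi\chi$; for every $R>0$ there is $C_R$ with $|\chi(x+z)-\chi(x)|\le C_R\chi(x)|z|$ for all $x$, $|z|\le R$, and $\sup_{|x-y|\le R}\chi(x)/\chi(y)\le C_R$. Write $\chi_j=\chi(x_j)$. Spatial differences. $h=2\nu\Delta x$ and $\Delta_hZ_j^n=Z_{j+2\nu}^n-Z_j^n$. Set $A_j^n=\chi_j\Delta_hU_j^n$, $B_j^n=\chi_j\Delta_hf_j^n$, $D_j^n=\chi_j\Delta_hS_j^n$, $E_j^n=\chi_j\Delta_hQ_j^n$ for $j\in\Omega_n$, and for $j\in\Omega_n'$ $$C_{A,j}^n=-\tfrac12\Delta_hU_{j+1}^n(\chi_{j+1}-\chi_j)+\tfrac12\Delta_hU_{j-1}^n(\chi_j-\chi_{j-1})+\tfrac\lambda2\Delta_hf_{j+1}^n(\chi_{j+1}-\chi_j)+\tfrac\lambda2\Delta_hf_{j-1}^n(\chi_j-\chi_{j-1}),$$ $$C_{D,j}^n=-\tfrac12\Delta_hS_{j+1}^n(\chi_{j+1}-\chi_j)+\tfrac12\Delta_hS_{j-1}^n(\chi_j-\chi_{j-1})+\tfrac\lambda2\Delta_hQ_{j+1}^n(\chi_{j+1}-\chi_j)+\tfrac\lambda2\Delta_hQ_{j-1}^n(\chi_j-\chi_{j-1})+\chi_j\Delta_h\Psi_j^n.$$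 Finally, for $j\in\Omega_n$, $\mathcal{A}_j^n=\Delta x\sum_{i\in\Omega_n,\,i\le j}A_i^n$ and $\mathcal{D}_j^n=\Delta x\sum_{\ell\in\Omega_n,\,\ell\ge j}D_\ell^n$. *)

theory Defs
  imports "HOL-Analysis.Analysis"
begin

text \<open>
  Differentiability classes on a set \<open>K\<close> that need not be open. They are only used for \<open>K = UNIV\<close>
  and for nondegenerate closed rectangles, where the derivative within \<open>K\<close> is unique; on a
  rectangle this is differentiability up to the boundary, with one-sided derivatives there.
\<close>

definition C1_on :: "'a::real_normed_vector set \<Rightarrow> ('a \<Rightarrow> 'b::real_normed_vector) \<Rightarrow> bool" where
  "C1_on K g \<longleftrightarrow>
    (\<exists>g' :: 'a \<Rightarrow> 'a \<Rightarrow>\<^sub>L 'b.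
      (\<forall>p\<in>K. (g has_derivative blinfun_apply (g' p)) (at p within K)) \<and> continuous_on K g')"

definition C2_on :: "'a::real_normed_vector set \<Rightarrow> ('a \<Rightarrow> 'b::real_normed_vector) \<Rightarrow> bool" where
  "C2_on K g \<longleftrightarrow>
    (\<exists>g' :: 'a \<Rightarrow> 'a \<Rightarrow>\<^sub>L 'b.
      (\<forall>p\<in>K. (g has_derivative blinfun_apply (g' p)) (at p within K)) \<and> C1_on K g')"

text \<open>Partial derivative in the second variable, which ranges over \<open>{a..b}\<close>
  (one-sided at the end points).\<close>

definition partial_u :: "real \<Rightarrow> real \<Rightarrow> (real \<times> real \<Rightarrow> real) \<Rightarrow> real \<times> real \<Rightarrow> real" where
  "partial_u a b g p = vector_derivative (\<lambda>v. g (fst p, v)) (at (snd p) within {a..b})"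

definition divergence :: "('a::euclidean_space \<Rightarrow> 'a) \<Rightarrow> 'a \<Rightarrow> real" where
  "divergence \<phi> x = (\<Sum>i\<in>Basis. frechet_derivative \<phi> (at x) i \<bullet> i)"

definition test_fields :: "'a::euclidean_space set \<Rightarrow> ('a \<Rightarrow> 'a) set" where
  "test_fields \<Omega> =
    {\<phi>. C1_on UNIV \<phi> \<and> (\<exists>K. compact K \<and> K \<subseteq> \<Omega> \<and> (\<forall>x. x \<notin> K \<longrightarrow> \<phi> x = 0)) \<and> (\<forall>x. norm (\<phi> x) \<le> 1)}"

text \<open>
  Essentially bounded functions on the open set \<open>\<Omega>\<close> whose total variation, in the usual sense of
  duality with test fields, is finite. Integrability over \<open>\<Omega>\<close> is not required: on the half plane a
  coefficient with a positive lower bound is never integrable.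
\<close>

definition Linf_BV_on :: "'a::euclidean_space set \<Rightarrow> ('a \<Rightarrow> real) \<Rightarrow> bool" where
  "Linf_BV_on \<Omega> g \<longleftrightarrow>
    g \<in> borel_measurable (lebesgue_on \<Omega>) \<and>
    (\<exists>M. AE x in lebesgue_on \<Omega>. \<bar>g x\<bar> \<le> M) \<and>
    bdd_above ((\<lambda>\<phi>. LINT x|lebesgue_on \<Omega>. g x * divergence \<phi> x) ` test_fields \<Omega>)"

text \<open>
  The staggered index sets at time level \<open>n\<close>. Grid functions have type \<^typ>\<open>nat \<Rightarrow> int \<Rightarrow> real\<close>
  (time level, then space index); a value \<open>Z n j\<close> with \<open>j\<close> outside the relevant index set carries
  no meaning.
\<close>

definition Om :: "nat \<Rightarrow> int set" where
  "Om n = {j. even (j + int n)}"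

definition Om' :: "nat \<Rightarrow> int set" where
  "Om' n = {j. odd (j + int n)}"

definition diff_h :: "nat \<Rightarrow> (nat \<Rightarrow> int \<Rightarrow> real) \<Rightarrow> nat \<Rightarrow> int \<Rightarrow> real" where
  "diff_h \<nu> Z n j = Z n (j + 2 * int \<nu>) - Z n j"

end

theory Submission
  imports Defs
begin

text \<open>
  Since the weight is integrable and comparable at neighbouring grid points, it is summable over the
  grid, so \<open>A\<close>, \<open>B\<close>, \<open>D\<close> and \<open>E\<close> are absolutely summable at each time level. The scheme says that
  \<open>A\<close> and \<open>D\<close> obey staggered conservation laws with fluxes \<open>B\<close>, \<open>E\<close> and sources \<open>CA\<close>, \<open>CD\<close>. Summing the
  first law from the left gives the evolution of the partial sums \<open>cA\<close>; inserting it together with the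
  second law into \<open>I (Suc n) = \<Delta>x * (\<Sum>j. D (Suc n) j * cA (Suc n) j)\<close> and exchanging the order of
  summation in the term pairing the two, the identity for a single time step holds up to a
  telescoping series. The time sum then telescopes in \<open>I\<close>.
\<close>

lemma Om'_eq: "Om' n = Om (Suc n)"
  by (auto simp: Om_def Om'_def)

section \<open>Absolute summability of real families\<close>

lemma real_has_sum_diff:
  fixes f g :: "'a \<Rightarrow> real"
  assumes "(f has_sum s) X" and "(g has_sum t) X"
  shows "((\<lambda>x. f x - g x) has_sum (s - t)) X"
  using has_sum_add[OF assms(1) has_sum_uminusI[OF assms(2)]] by simp

lemma real_summable_on_diff:
  fixes f g :: "'a \<Rightarrow> real"
  shows "f summable_on X \<Longrightarrow> g summable_on X \<Longrightarrow> (\<lambda>x. f x - g x) summable_on X"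
  unfolding summable_on_def by (blast intro: real_has_sum_diff)

lemma real_infsum_diff:
  fixes f g :: "'a \<Rightarrow> real"
  assumes "f summable_on X" and "g summable_on X"
  shows "(\<Sum>\<^sub>\<infinity>x\<in>X. f x - g x) = infsum f X - infsum g X"
  using assms by (intro infsumI real_has_sum_diff) simp_all

text \<open>For reals, unconditional summability is absolute, so comparison with
  \<open>C * f\<close> suffices. The bounded factors will be spatial differences of grid functions
  and one-sided partial sums.\<close>

lemma real_summable_on_mult_bounded:
  fixes f g :: "'a \<Rightarrow> real"
  assumes "f summable_on X" and "\<And>x. x \<in> X \<Longrightarrow> \<bar>g x\<bar> \<le> C"
  shows "(\<lambda>x. f x * g x) summable_on X"
proof -
  have "(\<lambda>x. norm (C * f x)) summable_on X"
    using assms(1) summable_on_cmult_right summable_on_iff_abs_summable_on_real by metis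
  moreover have "norm (f x * g x) \<le> norm (C * f x)" if "x \<in> X" for x
  proof -
    have "\<bar>g x\<bar> \<le> \<bar>C\<bar>" using assms(2)[OF that] by linarith
    then show ?thesis
      by (simp add: abs_mult mult.commute[of "\<bar>C\<bar>"] mult_left_mono)
  qed
  ultimately have "(\<lambda>x. norm (f x * g x)) summable_on X"
    by (rule Infinite_Sum.abs_summable_on_comparison_test)
  then show ?thesis
    by (rule Infinite_Sum.abs_summable_summable)
qed

text \<open>The bound is uniform in \<open>Y\<close>: with half-lines it makes one-sided partial
  sums bounded multipliers, and with singletons it bounds the individual terms.\<close>

lemma real_summable_on_abs_le_infsum:
  fixes g :: "'a \<Rightarrow> real"
  assumes "g summable_on X" and "Y \<subseteq> X"
  shows "\<bar>infsum g Y\<bar> \<le> (\<Sum>\<^sub>\<infinity>x\<in>X. \<bar>g x\<bar>)"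
proof -
  have X: "(\<lambda>x. norm (g x)) summable_on X"
    using assms(1) summable_on_iff_abs_summable_on_real by metis
  then have Y: "(\<lambda>x. norm (g x)) summable_on Y"
    using assms(2) summable_on_subset_banach by blast
  have "norm (infsum g Y) \<le> (\<Sum>\<^sub>\<infinity>x\<in>Y. norm (g x))"
    by (rule norm_infsum_bound[OF Y])
  also have "\<dots> \<le> (\<Sum>\<^sub>\<infinity>x\<in>X. norm (g x))"
    by (rule infsum_mono2[OF Y X]) (use assms(2) in auto)
  finally show ?thesis by simp
qed

lemma real_summable_on_mult:
  fixes f g :: "'a \<Rightarrow> real"
  assumes "f summable_on X" and "g summable_on X"
  shows "(\<lambda>x. f x * g x) summable_on X"
proof (rule real_summable_on_mult_bounded[OF assms(1)])
  fix x assume "x \<in> X"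
  then show "\<bar>g x\<bar> \<le> (\<Sum>\<^sub>\<infinity>x\<in>X. \<bar>g x\<bar>)"
    using real_summable_on_abs_le_infsum[OF assms(2), of "{x}"] by simp
qed

text \<open>The inner sums of absolute values are \<open>\<bar>f x\<bar>\<close> times a constant.
  Summability on the product is what later permits exchanging the order of summation.\<close>

lemma real_summable_on_Times:
  fixes f :: "'a \<Rightarrow> real" and g :: "'b \<Rightarrow> real"
  assumes "f summable_on X" and "g summable_on Y"
  shows "(\<lambda>(x, y). f x * g y) summable_on X \<times> Y"
proof -
  have X: "(\<lambda>x. norm (f x)) summable_on X" and Y: "(\<lambda>x. norm (g x)) summable_on Y"
    using assms summable_on_iff_abs_summable_on_real by metis+
  have "(\<lambda>x. \<bar>f x\<bar> * (\<Sum>\<^sub>\<infinity>y\<in>Y. \<bar>g y\<bar>)) summable_on X"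
    using X by (intro summable_on_cmult_left) simp
  moreover have "0 \<le> (\<Sum>\<^sub>\<infinity>y\<in>Y. \<bar>g y\<bar>)"
    by (simp add: infsum_nonneg)
  ultimately have "(\<lambda>p. norm (case p of (x, y) \<Rightarrow> f x * g y)) summable_on X \<times> Y"
    using Y by (subst Infinite_Sum.abs_summable_on_Sigma_iff)
      (auto simp: abs_mult infsum_cmult_right' intro!: summable_on_cmult_right)
  then show ?thesis
    by (rule Infinite_Sum.abs_summable_summable)
qed

section \<open>One-sided partial sums and summation over a triangle\<close>

text \<open>\<open>lsum\<close> and \<open>rsum\<close> are \<open>cA\<close> and \<open>cD\<close>
  stripped of the factor \<open>\<Delta>x\<close>. The cutoff \<open>j\<close> may lie outside
  \<open>P\<close>, which the shift rules below exploit.\<close>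

definition lsum :: "int set \<Rightarrow> (int \<Rightarrow> real) \<Rightarrow> int \<Rightarrow> real" where
  "lsum P g j = (\<Sum>\<^sub>\<infinity>i\<in>{i \<in> P. i \<le> j}. g i)"

definition rsum :: "int set \<Rightarrow> (int \<Rightarrow> real) \<Rightarrow> int \<Rightarrow> real" where
  "rsum P g j = (\<Sum>\<^sub>\<infinity>l\<in>{l \<in> P. j \<le> l}. g l)"

lemma lsum_abs_le: "g summable_on P \<Longrightarrow> \<bar>lsum P g j\<bar> \<le> (\<Sum>\<^sub>\<infinity>i\<in>P. \<bar>g i\<bar>)"
  and rsum_abs_le: "g summable_on P \<Longrightarrow> \<bar>rsum P g j\<bar> \<le> (\<Sum>\<^sub>\<infinity>i\<in>P. \<bar>g i\<bar>)"
  unfolding lsum_def rsum_def by (rule real_summable_on_abs_le_infsum; auto)+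

text \<open>Fubini on the triangle, with either coordinate summed first. Equating the two results is
  a discrete summation by parts: it moves the partial sum from one factor to the other.\<close>

lemma infsum_triangle_eq:
  fixes x y :: "int \<Rightarrow> real"
  assumes "x summable_on P" and "y summable_on P"
  shows infsum_triangle_lsum: "(\<Sum>\<^sub>\<infinity>(j, l)\<in>{(j, l). j \<in> P \<and> l \<in> P \<and> j \<le> l}. x j * y l) =
      (\<Sum>\<^sub>\<infinity>l\<in>P. y l * lsum P x l)"
    and infsum_triangle_rsum: "(\<Sum>\<^sub>\<infinity>(j, l)\<in>{(j, l). j \<in> P \<and> l \<in> P \<and> j \<le> l}. x j * y l) =
      (\<Sum>\<^sub>\<infinity>j\<in>P. x j * rsum P y j)"
proof -
  let ?T = "{(j, l). j \<in> P \<and> l \<in> P \<and> j \<le> l}"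
  have T: "?T = Sigma P (\<lambda>j. {l \<in> P. j \<le> l})"
    by auto
  have "(\<lambda>(j, l). x j * y l) summable_on P \<times> P"
    by (rule real_summable_on_Times[OF assms])
  then have "(\<lambda>(j, l). x j * y l) summable_on Sigma P (\<lambda>j. {l \<in> P. j \<le> l})"
    by (rule summable_on_subset_banach) auto
  from infsum_Sigma'_banach[OF this]
  show "infsum (\<lambda>(j, l). x j * y l) ?T = (\<Sum>\<^sub>\<infinity>j\<in>P. x j * rsum P y j)"
    by (simp add: T rsum_def infsum_cmult_right')
  \<comment> \<open>A \<open>Sigma\<close> set sums its second component inside, so the pair is
    swapped to make the smaller index the inner one.\<close>
  have "(\<lambda>(l, j). y l * x j) summable_on P \<times> P"
    by (rule real_summable_on_Times[OF assms(2,1)])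
  then have "(\<lambda>(l, j). y l * x j) summable_on Sigma P (\<lambda>l. {j \<in> P. j \<le> l})"
    by (rule summable_on_subset_banach) auto
  from infsum_Sigma'_banach[OF this]
  have "infsum (\<lambda>(l, j). y l * x j) (Sigma P (\<lambda>l. {j \<in> P. j \<le> l})) = (\<Sum>\<^sub>\<infinity>l\<in>P. y l * lsum P x l)"
    by (simp add: lsum_def infsum_cmult_right')
  moreover have "infsum (\<lambda>(j, l). x j * y l) ?T =
      infsum (\<lambda>(l, j). y l * x j) (Sigma P (\<lambda>l. {j \<in> P. j \<le> l}))"
    by (rule infsum_reindex_bij_witness[where i = prod.swap and j = prod.swap]) auto
  ultimately show "infsum (\<lambda>(j, l). x j * y l) ?T = (\<Sum>\<^sub>\<infinity>l\<in>P. y l * lsum P x l)"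
    by simp
qed

section \<open>Parity shifts between the two staggered index sets\<close>

lemma Om_shift_has_sum:
  shows Om'_has_sum_succ: "((\<lambda>j. g (j + 1)) has_sum s) (Om' n) \<longleftrightarrow> (g has_sum s) (Om n)"
    and Om'_has_sum_pred: "((\<lambda>j. g (j - 1)) has_sum s) (Om' n) \<longleftrightarrow> (g has_sum s) (Om n)"
proof -
  show "((\<lambda>j. g (j + 1)) has_sum s) (Om' n) \<longleftrightarrow> (g has_sum s) (Om n)"
    by (rule has_sum_reindex_bij_witness[where i = "\<lambda>j. j - 1" and j = "\<lambda>j. j + 1"])
      (auto simp: Om_def Om'_def)
  show "((\<lambda>j. g (j - 1)) has_sum s) (Om' n) \<longleftrightarrow> (g has_sum s) (Om n)"
    by (rule has_sum_reindex_bij_witness[where i = "\<lambda>j. j + 1" and j = "\<lambda>j. j - 1"])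
      (auto simp: Om_def Om'_def)
qed

lemma Om'_summable_succ: "(\<lambda>j. g (j + 1)) summable_on Om' n \<longleftrightarrow> g summable_on Om n"
  and Om'_summable_pred: "(\<lambda>j. g (j - 1)) summable_on Om' n \<longleftrightarrow> g summable_on Om n"
  by (simp_all add: summable_on_def Om'_has_sum_succ Om'_has_sum_pred)

text \<open>Both shifts are bijections onto \<open>Om n\<close>, so the two series have the same
  sum; no limit at infinity has to be taken.\<close>

lemma Om'_telescope:
  fixes g :: "int \<Rightarrow> real"
  assumes "g summable_on Om n"
  shows "((\<lambda>j. g (j + 1) - g (j - 1)) has_sum 0) (Om' n)"
proof -
  have "(g has_sum infsum g (Om n)) (Om n)"
    using assms by simp
  then have "((\<lambda>j. g (j + 1)) has_sum infsum g (Om n)) (Om' n)"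
    and "((\<lambda>j. g (j - 1)) has_sum infsum g (Om n)) (Om' n)"
    by (simp_all add: Om'_has_sum_succ Om'_has_sum_pred)
  from real_has_sum_diff[OF this] show ?thesis
    by simp
qed

lemma lsum_shift:
  shows lsum_succ: "lsum (Om' n) (\<lambda>i. g (i + 1)) j = lsum (Om n) g (j + 1)"
    and lsum_pred: "lsum (Om' n) (\<lambda>i. g (i - 1)) j = lsum (Om n) g (j - 1)"
proof -
  show "lsum (Om' n) (\<lambda>i. g (i + 1)) j = lsum (Om n) g (j + 1)"
    unfolding lsum_def
    by (rule infsum_reindex_bij_witness[where i = "\<lambda>j. j - 1" and j = "\<lambda>j. j + 1"])
      (auto simp: Om_def Om'_def)
  show "lsum (Om' n) (\<lambda>i. g (i - 1)) j = lsum (Om n) g (j - 1)"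
    unfolding lsum_def
    by (rule infsum_reindex_bij_witness[where i = "\<lambda>j. j + 1" and j = "\<lambda>j. j - 1"])
      (auto simp: Om_def Om'_def)
qed

lemma rsum_shift:
  shows rsum_succ: "rsum (Om' n) (\<lambda>i. g (i + 1)) j = rsum (Om n) g (j + 1)"
    and rsum_pred: "rsum (Om' n) (\<lambda>i. g (i - 1)) j = rsum (Om n) g (j - 1)"
proof -
  show "rsum (Om' n) (\<lambda>i. g (i + 1)) j = rsum (Om n) g (j + 1)"
    unfolding rsum_def
    by (rule infsum_reindex_bij_witness[where i = "\<lambda>j. j - 1" and j = "\<lambda>j. j + 1"])
      (auto simp: Om_def Om'_def)
  show "rsum (Om' n) (\<lambda>i. g (i - 1)) j = rsum (Om n) g (j - 1)"
    unfolding rsum_def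
    by (rule infsum_reindex_bij_witness[where i = "\<lambda>j. j + 1" and j = "\<lambda>j. j - 1"])
      (auto simp: Om_def Om'_def)
qed

text \<open>Moving the cutoff from \<open>j - 1\<close> to \<open>j + 1\<close> passes only
  \<open>j\<close> and \<open>j + 1\<close>, and \<open>j\<close> has the wrong parity, so a single
  term is gained.\<close>

lemma lsum_step:
  assumes "g summable_on Om n" and "j \<in> Om' n"
  shows "lsum (Om n) g (j + 1) = lsum (Om n) g (j - 1) + g (j + 1)"
proof -
  have *: "{i \<in> Om n. i \<le> j + 1} = insert (j + 1) {i \<in> Om n. i \<le> j - 1}"
  proof -
    have "i \<noteq> j" if "i \<in> Om n" for i
      using assms(2) that by (auto simp: Om_def Om'_def)
    then show ?thesis
      using assms(2) by (force simp: Om_def Om'_def)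
  qed
  show ?thesis
    unfolding lsum_def *
    by (subst infsum_insert)
      (auto intro: summable_on_subset_banach[OF assms(1)])
qed

lemma rsum_step:
  assumes "g summable_on Om n" and "j \<in> Om' n"
  shows "rsum (Om n) g (j - 1) = g (j - 1) + rsum (Om n) g (j + 1)"
proof -
  have *: "{i \<in> Om n. j - 1 \<le> i} = insert (j - 1) {i \<in> Om n. j + 1 \<le> i}"
  proof -
    have "i \<noteq> j" if "i \<in> Om n" for i
      using assms(2) that by (auto simp: Om_def Om'_def)
    then show ?thesis
      using assms(2) by (force simp: Om_def Om'_def)
  qed
  show ?thesis
    unfolding rsum_def *
    by (subst infsum_insert)
      (auto intro: summable_on_subset_banach[OF assms(1)])
qed

lemma lsum_linear:
  assumes "f summable_on P" and "g summable_on P"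
  shows lsum_add: "lsum P (\<lambda>i. f i + g i) j = lsum P f j + lsum P g j"
    and lsum_diff: "lsum P (\<lambda>i. f i - g i) j = lsum P f j - lsum P g j"
  unfolding lsum_def by (rule infsum_add real_infsum_diff; rule summable_on_subset_banach, rule assms, blast)+

lemma rsum_linear:
  assumes "f summable_on P" and "g summable_on P"
  shows rsum_add: "rsum P (\<lambda>i. f i + g i) j = rsum P f j + rsum P g j"
    and rsum_diff: "rsum P (\<lambda>i. f i - g i) j = rsum P f j - rsum P g j"
  unfolding rsum_def by (rule infsum_add real_infsum_diff; rule summable_on_subset_banach, rule assms, blast)+

lemma lsum_cmult: "lsum P (\<lambda>i. c * g i) j = c * lsum P g j"
  and rsum_cmult: "rsum P (\<lambda>i. c * g i) j = c * rsum P g j"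
  by (simp_all add: lsum_def rsum_def infsum_cmult_right')

lemma lsum_cong: "(\<And>i. i \<in> P \<Longrightarrow> f i = g i) \<Longrightarrow> lsum P f j = lsum P g j"
  by (auto simp: lsum_def intro!: infsum_cong)

section \<open>The identity for one time step\<close>

text \<open>This is the increment of the main identity at one level, divided by
  \<open>\<Delta>x\<^sup>2\<close>; since \<open>\<Delta>t = lam * \<Delta>x\<close>, only
  \<open>lam\<close> remains. Primed sequences belong to the next level, whose index set is
  \<open>Om' n\<close>.\<close>

lemma staggered_step:
  fixes a b d e a' d' ca cd :: "int \<Rightarrow> real" and lam :: real
  assumes a: "a summable_on Om n" and b: "b summable_on Om n"
    and d: "d summable_on Om n" and e: "e summable_on Om n"
    and a': "a' summable_on Om' n" and d': "d' summable_on Om' n"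
    and ca: "\<And>j. j \<in> Om' n \<Longrightarrow>
      a' j = 1/2 * (a (j - 1) + a (j + 1)) - lam/2 * (b (j + 1) - b (j - 1)) + ca j"
    and cd: "\<And>j. j \<in> Om' n \<Longrightarrow>
      d' j = 1/2 * (d (j - 1) + d (j + 1)) - lam/2 * (e (j + 1) - e (j - 1)) + cd j"
  shows "lam/2 * (\<Sum>\<^sub>\<infinity>j\<in>Om n. a j * e j - d j * b j) =
      - (\<Sum>\<^sub>\<infinity>j\<in>Om' n. cd j * lsum (Om' n) a' j)
      - (\<Sum>\<^sub>\<infinity>j\<in>Om' n. ca j * (1/2 * (rsum (Om n) d (j - 1) + rsum (Om n) d (j + 1))))
      + (\<Sum>\<^sub>\<infinity>j\<in>Om' n. d' j * lsum (Om' n) a' j)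
      - (\<Sum>\<^sub>\<infinity>j\<in>Om n. d j * lsum (Om n) a j)
      + lam\<^sup>2/4 * (\<Sum>\<^sub>\<infinity>j\<in>Om' n. e (j - 1) * (b (j + 1) - b (j - 1)))
      - lam/4 * (\<Sum>\<^sub>\<infinity>j\<in>Om' n. b (j + 1) * (d (j + 1) - d (j - 1)))
      - 1/4 * (\<Sum>\<^sub>\<infinity>j\<in>Om' n. (d (j - 1) + lam * e (j - 1)) * (a (j + 1) - a (j - 1)))
      - lam/2 * (\<Sum>\<^sub>\<infinity>j\<in>Om' n. e (j - 1) * ca j)"
proof -
  let ?P = "Om n" and ?Q = "Om' n"
  define L where "L = lsum ?P a"
  \<comment> \<open>The update of \<open>d\<close> without its source: \<open>d' = M + cd\<close> on
    \<open>Om' n\<close>.\<close>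
  define M where "M j = 1/2 * (d (j - 1) + d (j + 1)) - lam/2 * (e (j + 1) - e (j - 1))" for j
  \<comment> \<open>potential whose central difference is what remains of the single-step identity\<close>
  define G where "G j = - 1/2 * (d j * L j) - 1/4 * (d j * a j) - lam/2 * (e j * L j)
    - lam/4 * (e j * a j) + lam\<^sup>2/4 * (e j * b j)" for j
  note sum_intros = summable_on_add real_summable_on_diff summable_on_cmult_right real_summable_on_mult
  have shifted: "(\<lambda>j. a (j + 1)) summable_on ?Q" "(\<lambda>j. a (j - 1)) summable_on ?Q"
    "(\<lambda>j. b (j + 1)) summable_on ?Q" "(\<lambda>j. b (j - 1)) summable_on ?Q"
    "(\<lambda>j. d (j + 1)) summable_on ?Q" "(\<lambda>j. d (j - 1)) summable_on ?Q"
    "(\<lambda>j. e (j + 1)) summable_on ?Q" "(\<lambda>j. e (j - 1)) summable_on ?Q"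
    by (simp_all add: Om'_summable_succ Om'_summable_pred a b d e)
  have M: "M summable_on ?Q"
    unfolding M_def by (intro sum_intros shifted)
  \<comment> \<open>Solving the update for the source writes it as a difference of summable
    families; \<open>cd\<close> is treated in the same way.\<close>
  have ca_sum: "ca summable_on ?Q"
  proof -
    have "(\<lambda>j. a' j - (1/2 * (a (j - 1) + a (j + 1)) - lam/2 * (b (j + 1) - b (j - 1))))
        summable_on ?Q"
      by (intro sum_intros shifted a')
    then show ?thesis
      by (rule summable_on_cong[THEN iffD1, rotated]) (simp add: ca)
  qed
  have cd_sum: "cd summable_on ?Q"
  proof -
    have "(\<lambda>j. d' j - M j) summable_on ?Q"
      by (intro sum_intros M d')
    then show ?thesis
      by (rule summable_on_cong[THEN iffD1, rotated]) (simp add: cd M_def)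
  qed
  have L_mult: "(\<lambda>j. g j * L j) summable_on ?P" if "g summable_on ?P" for g
    by (rule real_summable_on_mult_bounded[OF that]) (unfold L_def, rule lsum_abs_le[OF a])
  have lsum_mult: "(\<lambda>j. g j * lsum ?Q h j) summable_on ?Q"
    if "g summable_on ?Q" "h summable_on ?Q" for g h
    by (rule real_summable_on_mult_bounded[OF that(1)]) (rule lsum_abs_le[OF that(2)])
  have rsum_mult: "(\<lambda>j. g j * (1/2 * (rsum ?P d (j - 1) + rsum ?P d (j + 1)))) summable_on ?Q"
    if "g summable_on ?Q" for g
  proof (rule real_summable_on_mult_bounded[OF that])
    have "\<bar>1/2 * (x + y)\<bar> \<le> s" if "\<bar>x\<bar> \<le> s" "\<bar>y\<bar> \<le> s" for x y s :: real
      using that by (auto simp: abs_le_iff)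
    then show "\<bar>1/2 * (rsum ?P d (j - 1) + rsum ?P d (j + 1))\<bar> \<le> (\<Sum>\<^sub>\<infinity>i\<in>?P. \<bar>d i\<bar>)" for j
      using rsum_abs_le[OF d] by blast
  qed
  \<comment> \<open>Summing the first law from the left, the flux differences collapse to the single
    boundary flux \<open>b (j + 1)\<close>.\<close>
  have lsum_a': "lsum ?Q a' j = 1/2 * (L (j - 1) + L (j + 1)) - lam/2 * b (j + 1) + lsum ?Q ca j"
    if "j \<in> ?Q" for j
  proof -
    have "lsum ?Q a' j = lsum ?Q (\<lambda>j. 1/2 * (a (j - 1) + a (j + 1))
        - lam/2 * (b (j + 1) - b (j - 1)) + ca j) j"
      by (rule lsum_cong) (simp add: ca)
    also have "\<dots> = 1/2 * (lsum ?P a (j - 1) + lsum ?P a (j + 1))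
        - lam/2 * (lsum ?P b (j + 1) - lsum ?P b (j - 1)) + lsum ?Q ca j"
      by (simp only: lsum_add lsum_diff lsum_cmult lsum_succ[where g = a] lsum_pred[where g = a]
          lsum_succ[where g = b] lsum_pred[where g = b] sum_intros shifted ca_sum)
    finally show ?thesis
      using lsum_step[OF b that] by (simp add: L_def)
  qed
  \<comment> \<open>Summing from the right leaves the flux at the other end,
    \<open>e (j - 1)\<close>, with the opposite sign. It produces the error term pairing
    \<open>e\<close> with \<open>ca\<close>.\<close>
  have rsum_M: "rsum ?Q M j = 1/2 * (rsum ?P d (j - 1) + rsum ?P d (j + 1)) + lam/2 * e (j - 1)"
    if "j \<in> ?Q" for j
  proof -
    have "rsum ?Q M j = 1/2 * (rsum ?P d (j - 1) + rsum ?P d (j + 1))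
        - lam/2 * (rsum ?P e (j + 1) - rsum ?P e (j - 1))"
      unfolding M_def
      by (simp only: rsum_add rsum_diff rsum_cmult rsum_succ[where g = d] rsum_pred[where g = d]
          rsum_succ[where g = e] rsum_pred[where g = e] sum_intros shifted)
    then show ?thesis
      using rsum_step[OF e that] by (simp add: algebra_simps)
  qed
  \<comment> \<open>Summation by parts frees \<open>ca\<close> from its partial sum, so that the
    averaged tails of \<open>d\<close> appear as its coefficient.\<close>
  have swap: "(\<Sum>\<^sub>\<infinity>j\<in>?Q. M j * lsum ?Q ca j) = (\<Sum>\<^sub>\<infinity>j\<in>?Q. ca j * rsum ?Q M j)"
    using infsum_triangle_lsum[OF ca_sum M] infsum_triangle_rsum[OF ca_sum M] by simp
  have "(\<Sum>\<^sub>\<infinity>j\<in>?Q. ca j * rsum ?Q M j) =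
      (\<Sum>\<^sub>\<infinity>j\<in>?Q. ca j * (1/2 * (rsum ?P d (j - 1) + rsum ?P d (j + 1))) + lam/2 * (e (j - 1) * ca j))"
    by (rule infsum_cong) (simp add: rsum_M algebra_simps)
  also have "\<dots> = (\<Sum>\<^sub>\<infinity>j\<in>?Q. ca j * (1/2 * (rsum ?P d (j - 1) + rsum ?P d (j + 1))))
      + lam/2 * (\<Sum>\<^sub>\<infinity>j\<in>?Q. e (j - 1) * ca j)"
    unfolding infsum_cmult_right'[symmetric]
    by (intro infsum_add sum_intros rsum_mult ca_sum shifted)
  finally have ca_part: "(\<Sum>\<^sub>\<infinity>j\<in>?Q. M j * lsum ?Q ca j) =
      (\<Sum>\<^sub>\<infinity>j\<in>?Q. ca j * (1/2 * (rsum ?P d (j - 1) + rsum ?P d (j + 1))))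
      + lam/2 * (\<Sum>\<^sub>\<infinity>j\<in>?Q. e (j - 1) * ca j)"
    unfolding swap .
  have G: "G summable_on ?P"
    unfolding G_def by (intro sum_intros L_mult a b d e)
  have hs: "(f has_sum infsum f X) X" if "f summable_on X" for f :: "int \<Rightarrow> real" and X
    using that by simp
  \<comment> \<open>One series is evaluated twice: by linearity here, and as a telescoping series
    with sum 0 below. Sums over \<open>Om n\<close> enter through the shift \<open>j + 1\<close>, so
    that everything runs over \<open>Om' n\<close>.\<close>
  have "((\<lambda>j. d' j * lsum ?Q a' j - cd j * lsum ?Q a' j - M j * lsum ?Q ca j
        - d (j + 1) * L (j + 1)
        + lam\<^sup>2/4 * (e (j - 1) * (b (j + 1) - b (j - 1)))
        - lam/4 * (b (j + 1) * (d (j + 1) - d (j - 1)))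
        - 1/4 * ((d (j - 1) + lam * e (j - 1)) * (a (j + 1) - a (j - 1)))
        - lam/2 * (a (j + 1) * e (j + 1) - d (j + 1) * b (j + 1))) has_sum
      ((\<Sum>\<^sub>\<infinity>j\<in>?Q. d' j * lsum ?Q a' j) - (\<Sum>\<^sub>\<infinity>j\<in>?Q. cd j * lsum ?Q a' j)
        - (\<Sum>\<^sub>\<infinity>j\<in>?Q. M j * lsum ?Q ca j) - (\<Sum>\<^sub>\<infinity>j\<in>?P. d j * L j)
        + lam\<^sup>2/4 * (\<Sum>\<^sub>\<infinity>j\<in>?Q. e (j - 1) * (b (j + 1) - b (j - 1)))
        - lam/4 * (\<Sum>\<^sub>\<infinity>j\<in>?Q. b (j + 1) * (d (j + 1) - d (j - 1)))
        - 1/4 * (\<Sum>\<^sub>\<infinity>j\<in>?Q. (d (j - 1) + lam * e (j - 1)) * (a (j + 1) - a (j - 1)))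
        - lam/2 * (\<Sum>\<^sub>\<infinity>j\<in>?P. a j * e j - d j * b j))) ?Q"
    by (intro has_sum_add real_has_sum_diff has_sum_cmult_right hs lsum_mult M ca_sum cd_sum a' d'
          sum_intros shifted
          Om'_has_sum_succ[where g = "\<lambda>j. d j * L j", THEN iffD2]
          Om'_has_sum_succ[where g = "\<lambda>j. a j * e j - d j * b j", THEN iffD2]
          L_mult a b d e)
  moreover have "((\<lambda>j. d' j * lsum ?Q a' j - cd j * lsum ?Q a' j - M j * lsum ?Q ca j
        - d (j + 1) * L (j + 1)
        + lam\<^sup>2/4 * (e (j - 1) * (b (j + 1) - b (j - 1)))
        - lam/4 * (b (j + 1) * (d (j + 1) - d (j - 1)))
        - 1/4 * ((d (j - 1) + lam * e (j - 1)) * (a (j + 1) - a (j - 1)))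
        - lam/2 * (a (j + 1) * e (j + 1) - d (j + 1) * b (j + 1))) has_sum 0) ?Q"
  proof (rule has_sum_cong[THEN iffD2, OF _ Om'_telescope[OF G]])
    fix j assume j: "j \<in> ?Q"
    have L: "L (j + 1) = L (j - 1) + a (j + 1)"
      unfolding L_def by (rule lsum_step[OF a j])
    \<comment> \<open>With \<open>d'\<close> and \<open>lsum ?Q a'\<close> both split into
      conservative and source parts, all source contributions cancel.\<close>
    have "d' j = M j + cd j"
      using cd[OF j] by (simp add: M_def)
    then have "d' j * lsum ?Q a' j - cd j * lsum ?Q a' j - M j * lsum ?Q ca j =
        M j * (1/2 * (L (j - 1) + L (j + 1)) - lam/2 * b (j + 1))"
      unfolding lsum_a'[OF j] by algebra
    then show "d' j * lsum ?Q a' j - cd j * lsum ?Q a' j - M j * lsum ?Q ca j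
        - d (j + 1) * L (j + 1)
        + lam\<^sup>2/4 * (e (j - 1) * (b (j + 1) - b (j - 1)))
        - lam/4 * (b (j + 1) * (d (j + 1) - d (j - 1)))
        - 1/4 * ((d (j - 1) + lam * e (j - 1)) * (a (j + 1) - a (j - 1)))
        - lam/2 * (a (j + 1) * e (j + 1) - d (j + 1) * b (j + 1)) = G (j + 1) - G (j - 1)"
      \<comment> \<open>The coefficient of \<open>L (j - 1)\<close> is
        \<open>M j - d (j + 1)\<close>, already a central difference. The three correction terms
        cancel the products of \<open>d\<close> or \<open>e\<close> at \<open>j - 1\<close> with
        \<open>a\<close> or \<open>b\<close> at \<open>j + 1\<close>; what survives is the
        difference of \<open>G\<close>.\<close>
      unfolding G_def M_def L by (simp add: field_simps power2_eq_square)
  qed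
  ultimately have "0 = (\<Sum>\<^sub>\<infinity>j\<in>?Q. d' j * lsum ?Q a' j) - (\<Sum>\<^sub>\<infinity>j\<in>?Q. cd j * lsum ?Q a' j)
        - (\<Sum>\<^sub>\<infinity>j\<in>?Q. M j * lsum ?Q ca j) - (\<Sum>\<^sub>\<infinity>j\<in>?P. d j * L j)
        + lam\<^sup>2/4 * (\<Sum>\<^sub>\<infinity>j\<in>?Q. e (j - 1) * (b (j + 1) - b (j - 1)))
        - lam/4 * (\<Sum>\<^sub>\<infinity>j\<in>?Q. b (j + 1) * (d (j + 1) - d (j - 1)))
        - 1/4 * (\<Sum>\<^sub>\<infinity>j\<in>?Q. (d (j - 1) + lam * e (j - 1)) * (a (j + 1) - a (j - 1)))
        - lam/2 * (\<Sum>\<^sub>\<infinity>j\<in>?P. a j * e j - d j * b j)"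
    using has_sum_unique by blast
  then show ?thesis
    unfolding ca_part L_def by linarith
qed

section \<open>Summability of the weighted grid quantities\<close>

text \<open>On each cell of length \<open>h\<close> the value of \<open>chi\<close> at the left end
  is at most \<open>C * chi x\<close>, so every finite sum times \<open>h\<close> is bounded by
  \<open>C\<close> times the integral.\<close>

lemma weight_summable_on_grid:
  fixes chi :: "real \<Rightarrow> real"
  assumes int: "integrable lborel chi" and h: "h > 0"
    and pos: "\<And>x. chi x > 0"
    and ratio: "\<And>x y. \<bar>x - y\<bar> \<le> h \<Longrightarrow> chi x / chi y \<le> C"
  shows "(\<lambda>j. chi (of_int j * h)) summable_on (UNIV :: int set)"
proof (rule nonneg_bounded_partial_sums_imp_summable_on)
  show "chi (of_int j * h) \<ge> 0" for j
    using pos less_imp_le by blast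
  \<comment> \<open>Half-open cells partition the line, so each \<open>x\<close> lies in exactly one
    of them, namely the one of index \<open>\<lfloor>x / h\<rfloor>\<close>.\<close>
  define J where "J j = {of_int j * h..<(of_int j + 1) * h}" for j :: int
  have J_measure: "integrable lborel (indicator (J j) :: real \<Rightarrow> real)"
    "integral\<^sup>L lborel (indicator (J j) :: real \<Rightarrow> real) = h" for j
    using h by (auto simp: J_def algebra_simps)
  have "(\<Sum>j\<in>F. chi (of_int j * h)) \<le> C * integral\<^sup>L lborel chi / h" if F: "finite F" for F
  proof -
    have "(\<Sum>j\<in>F. chi (of_int j * h)) * h =
        (\<Sum>j\<in>F. \<integral>x. chi (of_int j * h) * indicator (J j) x \<partial>lborel)"
      by (simp only: sum_distrib_right integral_mult_right_zero J_measure)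
    also have "\<dots> = (\<integral>x. (\<Sum>j\<in>F. chi (of_int j * h) * indicator (J j) x) \<partial>lborel)"
      by (rule Bochner_Integration.integral_sum[symmetric]) (simp add: J_measure)
    also have "\<dots> \<le> (\<integral>x. C * chi x \<partial>lborel)"
    proof (rule integral_mono)
      show "integrable lborel (\<lambda>x. \<Sum>j\<in>F. chi (of_int j * h) * indicator (J j) x)"
        by (intro Bochner_Integration.integrable_sum integrable_mult_right J_measure)
      show "integrable lborel (\<lambda>x. C * chi x)"
        using int by simp
      fix x :: real
      define m where "m = \<lfloor>x / h\<rfloor>"
      have m: "x \<in> J j \<longleftrightarrow> j = m" for j
      proof -
        have "x \<in> J j \<longleftrightarrow> of_int j \<le> x / h \<and> x / h < of_int j + 1"
          using h by (simp add: J_def field_simps)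
        then show ?thesis
          unfolding m_def by (auto simp: floor_unique floor_le_iff)
      qed
      have "\<bar>of_int m * h - x\<bar> \<le> h"
        using m[of m] by (auto simp: J_def algebra_simps)
      then have le: "chi (of_int m * h) \<le> C * chi x"
        using ratio[of "of_int m * h" x] pos[of x] by (simp add: divide_le_eq)
      have "(\<Sum>j\<in>F. chi (of_int j * h) * indicator (J j) x) =
          (\<Sum>j\<in>F. if j = m then chi (of_int m * h) else 0)"
        by (intro sum.cong refl) (auto simp: m indicator_def)
      also have "\<dots> \<le> C * chi x"
        using le less_imp_le[OF pos[of "of_int m * h"]] F by (simp add: sum.delta)
      finally show "(\<Sum>j\<in>F. chi (of_int j * h) * indicator (J j) x) \<le> C * chi x" .
    qed
    finally show ?thesis
      using h by (simp add: field_simps)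
  qed
  then show "\<forall>\<^sub>F F in finite_subsets_at_top UNIV. (\<Sum>j\<in>F. chi (of_int j * h)) \<le> C * integral\<^sup>L lborel chi / h"
    by (intro eventually_finite_subsets_at_top_weakI)
qed

lemma C1_on_bounded_on_compact:
  fixes g :: "'a::real_normed_vector \<Rightarrow> real"
  assumes "C1_on K g" and "compact K"
  shows "\<exists>M. \<forall>p\<in>K. \<bar>g p\<bar> \<le> M"
proof -
  have "continuous_on K g"
    using assms(1) by (auto simp: C1_on_def intro: has_derivative_continuous_on)
  then have "bounded (g ` K)"
    using assms(2) by (simp add: compact_continuous_image compact_imp_bounded)
  then show ?thesis
    by (simp add: bounded_iff)
qed

lemma C2_on_imp_C1_on:
  assumes "C2_on K g"
  shows "C1_on K g"
proof -
  obtain g' where "\<forall>p\<in>K. (g has_derivative blinfun_apply (g' p)) (at p within K)" and g': "C1_on K g'"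
    using assms by (auto simp: C2_on_def)
  moreover have "continuous_on K g'"
    using g' by (auto simp: C1_on_def intro: has_derivative_continuous_on)
  ultimately show ?thesis
    by (auto simp: C1_on_def)
qed

text \<open>The weight supplies the summability and the difference is merely bounded by
  \<open>2 * M\<close>. The shift by \<open>2 * int \<nu>\<close> preserves parity, so bounds on
  \<open>Om n\<close> alone control both values.\<close>

lemma weighted_diff_summable:
  assumes "w summable_on UNIV"
    and X: "\<And>j. j \<in> Om n \<Longrightarrow> X j = w j * diff_h \<nu> Z n j"
    and Z: "\<And>j. j \<in> Om n \<Longrightarrow> \<bar>Z n j\<bar> \<le> M"
  shows "X summable_on Om n"
proof -
  have "w summable_on Om n"
    using assms(1) by (rule summable_on_subset_banach) simp
  moreover have "\<bar>diff_h \<nu> Z n j\<bar> \<le> 2 * M" if "j \<in> Om n" for j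
    using Z[OF that] Z[of "j + 2 * int \<nu>"] that by (auto simp: diff_h_def Om_def)
  ultimately have "(\<lambda>j. w j * diff_h \<nu> Z n j) summable_on Om n"
    by (rule real_summable_on_mult_bounded)
  then show ?thesis
    by (subst summable_on_cong[OF X])
qed

section \<open>Assembly over all time levels\<close>

theorem lemma4p1:
  fixes a b \<alpha> \<beta> \<kappa> \<Delta>x \<Delta>t lam T :: real
    and u0 chi :: "real \<Rightarrow> real"
    and k :: "real \<Rightarrow> real \<Rightarrow> real"
    and f S Q :: "real \<times> real \<Rightarrow> real"
    and that :: "nat \<Rightarrow> real"
    and \<nu> N :: nat
    and U fg Sg Qg \<Psi> A B D E CA CD cA cD :: "nat \<Rightarrow> int \<Rightarrow> real"
    and w :: "int \<Rightarrow> real"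
    and I :: "nat \<Rightarrow> real"
    and Err :: real
  assumes ab: "a < b" and \<alpha>\<beta>: "\<alpha> < \<beta>"
    \<comment> \<open>data\<close>
    and u0_meas: "u0 \<in> borel_measurable lebesgue"
    and u0_bounds: "AE x in lebesgue. a \<le> u0 x \<and> u0 x \<le> b"
    and k_BV: "Linf_BV_on (UNIV \<times> {0<..}) (\<lambda>(x, t). k x t)"
    and k_bounds: "\<And>x t. t \<ge> 0 \<Longrightarrow> \<alpha> \<le> k x t \<and> k x t \<le> \<beta>"
    and k_rcont: "\<And>x t. t \<ge> 0 \<Longrightarrow> continuous (at_right x) (\<lambda>y. k y t)"
    and f_C1: "C1_on ({\<alpha>..\<beta>} \<times> {a..b}) f"
    and f_zero: "\<And>\<theta>. \<theta> \<in> {\<alpha>..\<beta>} \<Longrightarrow> f (\<theta>, a) = 0 \<and> f (\<theta>, b) = 0"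
    and S_C2: "C2_on ({\<alpha>..\<beta>} \<times> {a..b}) S"
    and Q_C1: "C1_on ({\<alpha>..\<beta>} \<times> {a..b}) Q"
    and compat: "\<And>p. p \<in> {\<alpha>..\<beta>} \<times> {a..b} \<Longrightarrow>
      partial_u a b Q p = partial_u a b S p * partial_u a b f p"
    \<comment> \<open>grid and scheme\<close>
    and \<Delta>x_pos: "\<Delta>x > 0" and \<Delta>t_pos: "\<Delta>t > 0" and lam_eq: "lam = \<Delta>t / \<Delta>x"
    and \<kappa>: "0 < \<kappa>" "\<kappa> < 1"
    and CFL: "lam * (SUP p\<in>{\<alpha>..\<beta>} \<times> {a..b}. \<bar>partial_u a b f p\<bar>) \<le> 1 - \<kappa>"
    and that: "\<And>n. real n * \<Delta>t \<le> that n \<and> that n < real (Suc n) * \<Delta>t"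
    and U_init: "\<And>j. j \<in> Om 0 \<Longrightarrow> U 0 j = 1 / (2 * \<Delta>x) *
      (LINT x:{of_int (j - 1) * \<Delta>x..of_int (j + 1) * \<Delta>x}|lebesgue. u0 x)"
    and fg: "\<And>n j. j \<in> Om n \<Longrightarrow> fg n j = f (k (of_int j * \<Delta>x) (that n), U n j)"
    and Sg: "\<And>n j. j \<in> Om n \<Longrightarrow> Sg n j = S (k (of_int j * \<Delta>x) (that n), U n j)"
    and Qg: "\<And>n j. j \<in> Om n \<Longrightarrow> Qg n j = Q (k (of_int j * \<Delta>x) (that n), U n j)"
    and scheme: "\<And>n j. j \<in> Om' n \<Longrightarrow> U (Suc n) j =
      1/2 * (U n (j - 1) + U n (j + 1)) - lam / 2 * (fg n (j + 1) - fg n (j - 1))"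
    and U_range: "\<And>n j. j \<in> Om n \<Longrightarrow> U n j \<in> {a..b}"
    and \<Psi>: "\<And>n j. j \<in> Om' n \<Longrightarrow> \<Psi> n j =
      Sg (Suc n) j - 1/2 * (Sg n (j - 1) + Sg n (j + 1)) + lam / 2 * (Qg n (j + 1) - Qg n (j - 1))"
    \<comment> \<open>weight function\<close>
    and chi_C1: "chi C1_differentiable_on UNIV"
    and chi_L1: "integrable lborel chi"
    and chi_pos: "\<And>x. chi x > 0"
    and chi_deriv: "\<exists>C. \<forall>x. \<bar>deriv chi x\<bar> \<le> C * chi x"
    and chi_local: "\<And>R. R > 0 \<Longrightarrow> \<exists>C.
      (\<forall>x z. \<bar>z\<bar> \<le> R \<longrightarrow> \<bar>chi (x + z) - chi x\<bar> \<le> C * chi x * \<bar>z\<bar>) \<and>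
      (\<forall>x y. \<bar>x - y\<bar> \<le> R \<longrightarrow> chi x / chi y \<le> C)"
    and w: "\<And>j. w j = chi (of_int j * \<Delta>x)"
    \<comment> \<open>weighted spatial differences\<close>
    and A: "\<And>n j. j \<in> Om n \<Longrightarrow> A n j = w j * diff_h \<nu> U n j"
    and B: "\<And>n j. j \<in> Om n \<Longrightarrow> B n j = w j * diff_h \<nu> fg n j"
    and D: "\<And>n j. j \<in> Om n \<Longrightarrow> D n j = w j * diff_h \<nu> Sg n j"
    and E: "\<And>n j. j \<in> Om n \<Longrightarrow> E n j = w j * diff_h \<nu> Qg n j"
    and CA: "\<And>n j. j \<in> Om' n \<Longrightarrow> CA n j =
      - 1/2 * diff_h \<nu> U n (j + 1) * (w (j + 1) - w j)
      + 1/2 * diff_h \<nu> U n (j - 1) * (w j - w (j - 1))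
      + lam / 2 * diff_h \<nu> fg n (j + 1) * (w (j + 1) - w j)
      + lam / 2 * diff_h \<nu> fg n (j - 1) * (w j - w (j - 1))"
    and CD: "\<And>n j. j \<in> Om' n \<Longrightarrow> CD n j =
      - 1/2 * diff_h \<nu> Sg n (j + 1) * (w (j + 1) - w j)
      + 1/2 * diff_h \<nu> Sg n (j - 1) * (w j - w (j - 1))
      + lam / 2 * diff_h \<nu> Qg n (j + 1) * (w (j + 1) - w j)
      + lam / 2 * diff_h \<nu> Qg n (j - 1) * (w j - w (j - 1))
      + w j * diff_h \<nu> \<Psi> n j"
    and cA: "\<And>n j. j \<in> Om n \<Longrightarrow> cA n j = \<Delta>x * (\<Sum>\<^sub>\<infinity>i\<in>{i \<in> Om n. i \<le> j}. A n i)"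
    and cD: "\<And>n j. j \<in> Om n \<Longrightarrow> cD n j = \<Delta>x * (\<Sum>\<^sub>\<infinity>l\<in>{l \<in> Om n. j \<le> l}. D n l)"
    \<comment> \<open>quantities of the lemma\<close>
    and T_pos: "T > 0" and N: "N = nat \<lfloor>T / \<Delta>t\<rfloor>"
    and I: "\<And>n. I n =
      \<Delta>x\<^sup>2 * (\<Sum>\<^sub>\<infinity>(j, l)\<in>{(j, l). j \<in> Om n \<and> l \<in> Om n \<and> j \<le> l}. A n j * D n l)"
    and Err: "Err =
      lam / 4 * \<Delta>t * \<Delta>x *
        (\<Sum>n=0..N. \<Sum>\<^sub>\<infinity>j\<in>Om' n. E n (j - 1) * (B n (j + 1) - B n (j - 1)))
      - 1/4 * \<Delta>t * \<Delta>x *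
        (\<Sum>n=0..N. \<Sum>\<^sub>\<infinity>j\<in>Om' n. B n (j + 1) * (D n (j + 1) - D n (j - 1)))
      - 1 / (4 * lam) * \<Delta>t * \<Delta>x *
        (\<Sum>n=0..N. \<Sum>\<^sub>\<infinity>j\<in>Om' n.
          (D n (j - 1) + lam * E n (j - 1)) * (A n (j + 1) - A n (j - 1)))
      - 1/2 * \<Delta>t * \<Delta>x *
        (\<Sum>n=0..N. \<Sum>\<^sub>\<infinity>j\<in>Om' n. E n (j - 1) * CA n j)"
  shows "1/2 * \<Delta>t * \<Delta>x * (\<Sum>n=0..N. \<Sum>\<^sub>\<infinity>j\<in>Om n. (A n j * E n j - D n j * B n j)) =
      - \<Delta>x * (\<Sum>n=0..N. \<Sum>\<^sub>\<infinity>j\<in>Om' n. CD n j * cA (Suc n) j)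
      - \<Delta>x * (\<Sum>n=0..N. \<Sum>\<^sub>\<infinity>j\<in>Om' n. CA n j * (1/2 * (cD n (j - 1) + cD n (j + 1))))
      + I (Suc N) - I 0 + Err"
proof -
  \<comment> \<open>Saved under another name because \<open>that\<close> denotes the local premise
    inside the blocks with \<open>if\<close> below.\<close>
  note time_bounds = that
  let ?K = "{\<alpha>..\<beta>} \<times> {a..b}"
  have lam: "lam > 0" and dt: "\<Delta>t = lam * \<Delta>x"
    using \<Delta>x_pos \<Delta>t_pos by (simp_all add: lam_eq)
  have w_sum: "w summable_on UNIV"
  proof -
    obtain C where "\<And>x y. \<bar>x - y\<bar> \<le> \<Delta>x \<Longrightarrow> chi x / chi y \<le> C"
      using chi_local[OF \<Delta>x_pos] by blast
    from weight_summable_on_grid[OF chi_L1 \<Delta>x_pos chi_pos this] show ?thesis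
      by (subst summable_on_cong[OF w])
  qed
  \<comment> \<open>All arguments stay in a compact rectangle, on which \<open>f\<close>,
    \<open>S\<close> and \<open>Q\<close> are bounded by continuity.\<close>
  have K: "(k (of_int j * \<Delta>x) (that n), U n j) \<in> ?K" if "j \<in> Om n" for n j
  proof -
    have "that n \<ge> 0"
      using time_bounds[of n] \<Delta>t_pos by (meson less_imp_le mult_nonneg_nonneg of_nat_0_le_iff order_trans)
    then show ?thesis
      using k_bounds U_range[OF that] by auto
  qed
  have K_compact: "compact ?K"
    by (intro compact_Times compact_Icc)
  have A_sum: "A n summable_on Om n" for n
    by (rule weighted_diff_summable[OF w_sum A, where M = "max \<bar>a\<bar> \<bar>b\<bar>"])
      (use U_range in \<open>force simp: abs_le_iff le_max_iff_disj\<close>)+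
  have B_sum: "B n summable_on Om n" for n
  proof -
    obtain M where "\<And>p. p \<in> ?K \<Longrightarrow> \<bar>f p\<bar> \<le> M"
      using C1_on_bounded_on_compact[OF f_C1 K_compact] by blast
    then show ?thesis
      by (intro weighted_diff_summable[OF w_sum B, where M = M]) (simp_all only: fg K)
  qed
  have D_sum: "D n summable_on Om n" for n
  proof -
    obtain M where "\<And>p. p \<in> ?K \<Longrightarrow> \<bar>S p\<bar> \<le> M"
      using C1_on_bounded_on_compact[OF C2_on_imp_C1_on[OF S_C2] K_compact] by blast
    then show ?thesis
      by (intro weighted_diff_summable[OF w_sum D, where M = M]) (simp_all only: Sg K)
  qed
  have E_sum: "E n summable_on Om n" for n
  proof -
    obtain M where "\<And>p. p \<in> ?K \<Longrightarrow> \<bar>Q p\<bar> \<le> M"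
      using C1_on_bounded_on_compact[OF Q_C1 K_compact] by blast
    then show ?thesis
      by (intro weighted_diff_summable[OF w_sum E, where M = M]) (simp_all only: Qg K)
  qed
  have nbr: "j - 1 \<in> Om n" "j + 1 \<in> Om n" "j \<in> Om (Suc n)" "j + 2 * int \<nu> \<in> Om' n"
    if "j \<in> Om' n" for n j
    using that by (auto simp: Om_def Om'_def)
  \<comment> \<open>\<open>CA\<close> is the commutator of the weight with the scheme: the update
    carries \<open>w j\<close>, the neighbouring \<open>A\<close> and \<open>B\<close> carry
    \<open>w (j - 1)\<close> and \<open>w (j + 1)\<close>. The scheme is applied at \<open>j\<close>
    and at \<open>j + 2 * int \<nu>\<close>.\<close>
  have A_step: "A (Suc n) j = 1/2 * (A n (j - 1) + A n (j + 1))
      - lam/2 * (B n (j + 1) - B n (j - 1)) + CA n j" if j: "j \<in> Om' n" for n j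
    unfolding A[OF nbr(1)[OF j]] A[OF nbr(2)[OF j]] A[OF nbr(3)[OF j]] B[OF nbr(1)[OF j]]
      B[OF nbr(2)[OF j]] CA[OF j] diff_h_def scheme[OF j] scheme[OF nbr(4)[OF j]]
    by (simp add: field_simps)
  \<comment> \<open>The definition of \<open>\<Psi>\<close> takes the place of the scheme, so
    \<open>CD\<close> contains its weighted difference besides the commutator.\<close>
  have D_step: "D (Suc n) j = 1/2 * (D n (j - 1) + D n (j + 1))
      - lam/2 * (E n (j + 1) - E n (j - 1)) + CD n j" if j: "j \<in> Om' n" for n j
    unfolding D[OF nbr(1)[OF j]] D[OF nbr(2)[OF j]] D[OF nbr(3)[OF j]] E[OF nbr(1)[OF j]]
      E[OF nbr(2)[OF j]] CD[OF j] diff_h_def \<Psi>[OF j] \<Psi>[OF nbr(4)[OF j]]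
    by (simp add: field_simps)
  have I_eq: "I n = \<Delta>x\<^sup>2 * (\<Sum>\<^sub>\<infinity>l\<in>Om n. D n l * lsum (Om n) (A n) l)" for n
    unfolding I by (simp add: infsum_triangle_lsum[OF A_sum D_sum])
  have cA_eq: "(\<Sum>\<^sub>\<infinity>j\<in>Om' n. CD n j * cA (Suc n) j) =
      \<Delta>x * (\<Sum>\<^sub>\<infinity>j\<in>Om' n. CD n j * lsum (Om' n) (A (Suc n)) j)" for n
    unfolding infsum_cmult_right'[symmetric]
    by (rule infsum_cong) (simp add: cA nbr lsum_def Om'_eq)
  have cD_eq: "(\<Sum>\<^sub>\<infinity>j\<in>Om' n. CA n j * (1/2 * (cD n (j - 1) + cD n (j + 1)))) =
      \<Delta>x * (\<Sum>\<^sub>\<infinity>j\<in>Om' n. CA n j * (1/2 * (rsum (Om n) (D n) (j - 1) + rsum (Om n) (D n) (j + 1))))" for n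
    unfolding infsum_cmult_right'[symmetric]
    by (rule infsum_cong) (simp add: cD nbr rsum_def algebra_simps)
  \<comment> \<open>Naming the infinite sums leaves only linear algebra in real numbers.\<close>
  define X1 where "X1 n = (\<Sum>\<^sub>\<infinity>j\<in>Om' n. E n (j - 1) * (B n (j + 1) - B n (j - 1)))" for n
  define X2 where "X2 n = (\<Sum>\<^sub>\<infinity>j\<in>Om' n. B n (j + 1) * (D n (j + 1) - D n (j - 1)))" for n
  define X3 where "X3 n = (\<Sum>\<^sub>\<infinity>j\<in>Om' n.
    (D n (j - 1) + lam * E n (j - 1)) * (A n (j + 1) - A n (j - 1)))" for n
  define X4 where "X4 n = (\<Sum>\<^sub>\<infinity>j\<in>Om' n. E n (j - 1) * CA n j)" for n
  define Y where "Y n = (\<Sum>\<^sub>\<infinity>j\<in>Om n. A n j * E n j - D n j * B n j)" for n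
  define Z1 where "Z1 n = (\<Sum>\<^sub>\<infinity>j\<in>Om' n. CD n j * cA (Suc n) j)" for n
  define Z2 where "Z2 n = (\<Sum>\<^sub>\<infinity>j\<in>Om' n. CA n j * (1/2 * (cD n (j - 1) + cD n (j + 1))))" for n
  have step: "1/2 * \<Delta>t * \<Delta>x * Y n = - \<Delta>x * Z1 n - \<Delta>x * Z2 n + I (Suc n) - I n
      + lam / 4 * \<Delta>t * \<Delta>x * X1 n - 1/4 * \<Delta>t * \<Delta>x * X2 n
      - 1 / (4 * lam) * \<Delta>t * \<Delta>x * X3 n - 1/2 * \<Delta>t * \<Delta>x * X4 n" for n
  proof -
    define J1 where "J1 = (\<Sum>\<^sub>\<infinity>j\<in>Om' n. D (Suc n) j * lsum (Om' n) (A (Suc n)) j)"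
    define J0 where "J0 = (\<Sum>\<^sub>\<infinity>j\<in>Om n. D n j * lsum (Om n) (A n) j)"
    define W1 where "W1 = (\<Sum>\<^sub>\<infinity>j\<in>Om' n. CD n j * lsum (Om' n) (A (Suc n)) j)"
    define W2 where "W2 = (\<Sum>\<^sub>\<infinity>j\<in>Om' n. CA n j * (1/2 * (rsum (Om n) (D n) (j - 1) + rsum (Om n) (D n) (j + 1))))"
    have "lam/2 * Y n = - W1 - W2 + J1 - J0 + lam\<^sup>2/4 * X1 n - lam/4 * X2 n - 1/4 * X3 n - lam/2 * X4 n"
      unfolding Y_def W1_def W2_def J1_def J0_def X1_def X2_def X3_def X4_def
      by (rule staggered_step[OF A_sum B_sum D_sum E_sum
            A_sum[of "Suc n", folded Om'_eq] D_sum[of "Suc n", folded Om'_eq] A_step D_step])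
    \<comment> \<open>The factor \<open>\<Delta>x\<^sup>2\<close> is that of \<open>I\<close>. In
      the source terms one power of \<open>\<Delta>x\<close> is absorbed by \<open>cA\<close> or
      \<open>cD\<close>; in the others \<open>\<Delta>x\<^sup>2 * lam\<close> is
      \<open>\<Delta>t * \<Delta>x\<close>.\<close>
    then have "\<Delta>x\<^sup>2 * (lam/2 * Y n) = \<Delta>x\<^sup>2 * (- W1 - W2 + J1 - J0 + lam\<^sup>2/4 * X1 n
        - lam/4 * X2 n - 1/4 * X3 n - lam/2 * X4 n)"
      by simp
    moreover have "I (Suc n) = \<Delta>x\<^sup>2 * J1" "I n = \<Delta>x\<^sup>2 * J0"
      by (simp_all add: I_eq J1_def J0_def Om'_eq)
    moreover have "Z1 n = \<Delta>x * W1" "Z2 n = \<Delta>x * W2"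
      by (simp_all only: Z1_def Z2_def W1_def W2_def cA_eq cD_eq)
    ultimately show ?thesis
      using lam by (simp add: dt field_simps power2_eq_square)
  qed
  \<comment> \<open>Induction on the last level; the increments \<open>I (Suc n) - I n\<close>
    telescope.\<close>
  have "1/2 * \<Delta>t * \<Delta>x * (\<Sum>n=0..m. Y n) =
      - \<Delta>x * (\<Sum>n=0..m. Z1 n) - \<Delta>x * (\<Sum>n=0..m. Z2 n) + I (Suc m) - I 0
      + (lam / 4 * \<Delta>t * \<Delta>x * (\<Sum>n=0..m. X1 n) - 1/4 * \<Delta>t * \<Delta>x * (\<Sum>n=0..m. X2 n)
      - 1 / (4 * lam) * \<Delta>t * \<Delta>x * (\<Sum>n=0..m. X3 n) - 1/2 * \<Delta>t * \<Delta>x * (\<Sum>n=0..m. X4 n))" for m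
  proof (induction m)
    case 0
    then show ?case using step[of 0] by simp
  next
    case (Suc m)
    then show ?case
      using step[of "Suc m"] by (simp only: sum.atLeast0_atMost_Suc distrib_left)
  qed
  then show ?thesis
    unfolding Err Y_def Z1_def Z2_def X1_def X2_def X3_def X4_def .
qed

end
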